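(* For every $n\ge 0$, there is a bijection $\Phi:FP_n\to\mathcal D_n$, where $\mathcal D_n$ denotes the set of Dyck paths of semilength $n$.
   Context: $I_n$ is the set of inversion sequences of length $n$, i.e. integer sequences $\sigma=(\sigma_1,\ldots,\sigma_n)$ with $0\le\sigma_i<i$ for every $1\le i\le n$ (the empty sequence is allowed, with $n=0$). For a finite integer sequence $\sigma$ of length $n$, $\Theta(\sigma)$ is the sequence of length $n$ defined by $\Theta(\sigma)_i=\#\{j<i:\sigma_j<\sigma_i\}$. $FP_n=\{\sigma\in I_n:\Theta(\sigma)=\sigma\}$. A Dyck path of semilength $n$ is a word with $n$ letters $U$ (up steps) and $n$ letters $D$ (down steps) such that every prefix contains at least as many $U$'s as $D$'s. *)

theory Defs
  imports Main "HOL-Library.Sublist"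
begin

text \<open>
  Sequences are lists, whose positions start at \<open>0\<close>: the paper's entry \<open>\<sigma>\<^sub>i\<close>
  with \<open>1 \<le> i \<le> n\<close> is \<open>\<sigma> ! (i - 1)\<close>. Hence the bound \<open>\<sigma>\<^sub>i < i\<close>
  reads \<open>\<sigma> ! i < int (i + 1)\<close>.
\<close>

definition inversion_seqs :: "nat \<Rightarrow> int list set" where
  "inversion_seqs n =
     {\<sigma>. length \<sigma> = n \<and> (\<forall>i<n. 0 \<le> \<sigma> ! i \<and> \<sigma> ! i < int (i + 1))}"

definition Theta :: "int list \<Rightarrow> int list" where
  "Theta \<sigma> = map (\<lambda>i. int (card {j. j < i \<and> \<sigma> ! j < \<sigma> ! i})) [0..<length \<sigma>]"

definition FP :: "nat \<Rightarrow> int list set" where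
  "FP n = {\<sigma> \<in> inversion_seqs n. Theta \<sigma> = \<sigma>}"

datatype step = U | D

definition dyck_paths :: "nat \<Rightarrow> step list set" where
  "dyck_paths n =
     {w. count_list w U = n \<and> count_list w D = n \<and>
         (\<forall>p. prefix p w \<longrightarrow> count_list p D \<le> count_list p U)}"

end

theory Submission
  imports Defs
begin

text \<open>
  Call a value \<open>v\<close> active for a fixed point \<open>\<sigma>\<close> of \<open>\<Theta>\<close> if \<open>\<sigma>\<close> followed by \<open>v\<close> is again a
  fixed point. Since at least \<open>v\<close> entries of \<open>\<sigma>\<close> are smaller than \<open>v\<close> whenever
  \<open>v \<le> length \<sigma>\<close>, appending an active \<open>k\<close> keeps exactly the active values up to \<open>k\<close> and creates
  the single new one \<open>length \<sigma> + 1\<close>. So a fixed point with \<open>h + 1\<close> active values has \<open>h + 1\<close>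
  children, which have \<open>2, \<dots>, h + 2\<close> active values. Completions to a Dyck path of a prefix of
  height \<open>h\<close> obey the same Catalan recursion: take some of the \<open>h\<close> available down steps, then
  an up step, which leads to one of the heights \<open>1, \<dots>, h + 1\<close>.
\<close>

definition smaller :: "int list \<Rightarrow> int \<Rightarrow> nat" where
  "smaller \<sigma> v = length (filter (\<lambda>x. x < v) \<sigma>)"

definition active :: "int list \<Rightarrow> int set" where
  "active \<sigma> = {v. int (smaller \<sigma> v) = v}"

lemma smaller_le_length: "smaller \<sigma> v \<le> length \<sigma>"
  by (simp add: smaller_def)

lemma smaller_snoc: "smaller (\<sigma> @ [k]) v = smaller \<sigma> v + (if k < v then 1 else 0)"
  by (simp add: smaller_def)

lemma active_bounds: "v \<in> active \<sigma> \<Longrightarrow> 0 \<le> v \<and> v \<le> int (length \<sigma>)"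
  using smaller_le_length[of \<sigma> v] by (auto simp: active_def)

lemma finite_active: "finite (active \<sigma>)"
  by (rule finite_subset[of _ "{0..int (length \<sigma>)}"]) (auto dest: active_bounds)

lemma length_Theta [simp]: "length (Theta \<sigma>) = length \<sigma>"
  by (simp add: Theta_def)

text \<open>Each entry of \<open>Theta\<close> looks only at earlier positions, so the old entries
  survive appending.\<close>

lemma Theta_snoc: "Theta (\<sigma> @ [k]) = Theta \<sigma> @ [int (smaller \<sigma> k)]"
proof -
  have "{j. j < length \<sigma> \<and> (\<sigma> @ [k]) ! j < k} = {j. j < length \<sigma> \<and> \<sigma> ! j < k}"
    by (auto simp: nth_append)
  moreover have "{j. j < i \<and> (\<sigma> @ [k]) ! j < (\<sigma> @ [k]) ! i} = {j. j < i \<and> \<sigma> ! j < \<sigma> ! i}"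
    if "i < length \<sigma>" for i
    using that by (auto simp: nth_append)
  ultimately show ?thesis
    by (simp add: Theta_def smaller_def length_filter_conv_card)
qed

lemma Theta_fixed_snoc_iff:
  "Theta (\<sigma> @ [k]) = \<sigma> @ [k] \<longleftrightarrow> Theta \<sigma> = \<sigma> \<and> k \<in> active \<sigma>"
  by (simp add: Theta_snoc active_def)

lemma Theta_fixed_prefix: "Theta (\<sigma> @ \<tau>) = \<sigma> @ \<tau> \<Longrightarrow> Theta \<sigma> = \<sigma>"
proof (induction \<tau> rule: rev_induct)
  case (snoc k \<tau>)
  then show ?case
    using Theta_fixed_snoc_iff[of "\<sigma> @ \<tau>" k] by simp
qed simp

lemma Theta_fixed_entry_less:
  "Theta \<sigma> = \<sigma> \<Longrightarrow> x \<in> set \<sigma> \<Longrightarrow> x < int (length \<sigma>)"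
proof (induction \<sigma> rule: rev_induct)
  case (snoc k \<sigma>)
  then show ?case
    using active_bounds[of k \<sigma>] by (fastforce simp: Theta_fixed_snoc_iff)
qed simp

lemma smaller_eq_length:
  assumes "Theta \<sigma> = \<sigma>" "int (length \<sigma>) \<le> v"
  shows "smaller \<sigma> v = length \<sigma>"
proof -
  have "filter (\<lambda>x. x < v) \<sigma> = \<sigma>"
    using Theta_fixed_entry_less[OF assms(1)] assms(2) by (force simp: filter_id_conv)
  then show ?thesis
    by (simp add: smaller_def)
qed

text \<open>Counts never drop on appending, which settles \<open>v\<close> up to the old length.
  Otherwise \<open>v\<close> is the new length, and all entries lie below it.\<close>

lemma le_smaller:
  "Theta \<sigma> = \<sigma> \<Longrightarrow> v \<le> int (length \<sigma>) \<Longrightarrow> v \<le> int (smaller \<sigma> v)"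
proof (induction \<sigma> rule: rev_induct)
  case (snoc k \<sigma>)
  show ?case
  proof (cases "v \<le> int (length \<sigma>)")
    case True
    then show ?thesis
      using snoc by (fastforce simp: Theta_fixed_snoc_iff smaller_snoc)
  next
    case False
    then show ?thesis
      using smaller_eq_length[OF snoc.prems(1), of v] snoc.prems(2) by simp
  qed
qed (simp add: smaller_def)

lemma active_snoc:
  assumes fp: "Theta \<sigma> = \<sigma>" and k: "k \<in> active \<sigma>"
  shows "active (\<sigma> @ [k]) = insert (int (length \<sigma>) + 1) {v \<in> active \<sigma>. v \<le> k}"
proof (rule set_eqI)
  fix v
  show "v \<in> active (\<sigma> @ [k]) \<longleftrightarrow> v \<in> insert (int (length \<sigma>) + 1) {v \<in> active \<sigma>. v \<le> k}"
  proof (cases "v \<le> int (length \<sigma>)")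
    case True
    \<comment> \<open>If \<open>k < v\<close>, a count that is already at least \<open>v\<close>
      grows, so \<open>v\<close> is not active afterwards; if \<open>v \<le> k\<close>, the count is
      unchanged.\<close>
    then show ?thesis
      using le_smaller[OF fp True] by (auto simp: active_def smaller_snoc)
  next
    case False
    \<comment> \<open>Now \<open>k\<close> and all of \<open>\<sigma>\<close> lie below
      \<open>v\<close>, so the new count is \<open>length \<sigma> + 1\<close>, the only candidate
      for \<open>v\<close>.\<close>
    then show ?thesis
      using smaller_eq_length[OF fp, of v] active_bounds[OF k]
      by (auto simp: active_def smaller_snoc)
  qed
qed

lemma card_active_snoc:
  assumes "Theta \<sigma> = \<sigma>" "k \<in> active \<sigma>"
  shows "card (active (\<sigma> @ [k])) = Suc (card {v \<in> active \<sigma>. v \<le> k})"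
proof -
  have "int (length \<sigma>) + 1 \<notin> active \<sigma>"
    using active_bounds by fastforce
  then show ?thesis
    using finite_active[of \<sigma>] by (simp add: active_snoc[OF assms])
qed

text \<open>The ranks in \<open>A\<close> run once through \<open>1, ..., card A\<close>: the
  maximum has rank \<open>card A\<close>, and removing it changes no other rank.\<close>

lemma sum_over_ranks:
  fixes A :: "'a::linorder set"
  assumes "finite A"
  shows "(\<Sum>k\<in>A. f (card {v \<in> A. v \<le> k})) = (\<Sum>j=1..card A. f j)"
  using assms
proof (induction A rule: finite_linorder_max_induct)
  case (insert b A)
  have "{v \<in> insert b A. v \<le> b} = insert b A"
    using insert.hyps by (auto intro: less_imp_le)
  moreover have "{v \<in> insert b A. v \<le> k} = {v \<in> A. v \<le> k}" if "k \<in> A" for k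
    using that insert.hyps by auto
  moreover have "b \<notin> A"
    using insert.hyps by auto
  ultimately show ?case
    using insert by (simp add: add.commute)
qed simp

definition fixed_extensions :: "nat \<Rightarrow> int list \<Rightarrow> int list set" where
  "fixed_extensions m \<sigma> = {\<tau>. length \<tau> = m \<and> Theta (\<sigma> @ \<tau>) = \<sigma> @ \<tau>}"

lemma fixed_extensions_Suc:
  "fixed_extensions (Suc m) \<sigma> = (\<Union>k\<in>active \<sigma>. (#) k ` fixed_extensions m (\<sigma> @ [k]))"
proof -
  \<comment> \<open>Being fixed passes to the prefix \<open>\<sigma> @ [k]\<close>, which forces
    \<open>k\<close> to be active.\<close>
  have "k \<in> active \<sigma>" if "Theta (\<sigma> @ k # \<tau>) = \<sigma> @ k # \<tau>" for k \<tau>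
    using Theta_fixed_prefix[of "\<sigma> @ [k]" \<tau>] that by (simp add: Theta_fixed_snoc_iff)
  then show ?thesis
    by (auto simp: fixed_extensions_def length_Suc_conv)
qed

text \<open>Completions from height \<open>h\<close> are indexed by their up steps, not their
  length, because each up step will match one sequence entry.\<close>

definition dyck_suffixes :: "nat \<Rightarrow> nat \<Rightarrow> step list set" where
  "dyck_suffixes m h =
     {w. count_list w U = m \<and> count_list w D = m + h \<and>
         (\<forall>p. prefix p w \<longrightarrow> count_list p D \<le> h + count_list p U)}"

lemma Nil_in_dyck_suffixes: "[] \<in> dyck_suffixes m h \<longleftrightarrow> m = 0 \<and> h = 0"
  by (auto simp: dyck_suffixes_def)

lemma U_Cons_in_dyck_suffixes:
  "U # w \<in> dyck_suffixes m h \<longleftrightarrow> (\<exists>m'. m = Suc m' \<and> w \<in> dyck_suffixes m' (Suc h))"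
  by (cases m) (auto simp: dyck_suffixes_def prefix_Cons)

lemma D_Cons_in_dyck_suffixes:
  "D # w \<in> dyck_suffixes m h \<longleftrightarrow> (\<exists>h'. h = Suc h' \<and> w \<in> dyck_suffixes m h')"
proof (cases h)
  case 0
  then show ?thesis
    \<comment> \<open>At height 0 the prefix \<open>[D]\<close> already falls below the
      axis.\<close>
    by (auto simp: dyck_suffixes_def intro!: exI[of _ "[D]"])
next
  case (Suc h')
  then show ?thesis
    by (auto simp: dyck_suffixes_def prefix_Cons)
qed

lemma dyck_suffixes_eq:
  "dyck_suffixes m h =
     {w. w = [] \<and> m = 0 \<and> h = 0} \<union>
     {w. \<exists>m' v. m = Suc m' \<and> w = U # v \<and> v \<in> dyck_suffixes m' (Suc h)} \<union>
     {w. \<exists>h' v. h = Suc h' \<and> w = D # v \<and> v \<in> dyck_suffixes m h'}"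
proof -
  have "w \<in> dyck_suffixes m h \<longleftrightarrow>
    (w = [] \<and> m = 0 \<and> h = 0) \<or>
    (\<exists>m' v. m = Suc m' \<and> w = U # v \<and> v \<in> dyck_suffixes m' (Suc h)) \<or>
    (\<exists>h' v. h = Suc h' \<and> w = D # v \<and> v \<in> dyck_suffixes m h')" for w
  proof (cases w)
    case (Cons s v)
    then show ?thesis
      by (cases s) (auto simp: U_Cons_in_dyck_suffixes D_Cons_in_dyck_suffixes)
  qed (simp add: Nil_in_dyck_suffixes)
  then show ?thesis
    by blast
qed

lemma dyck_suffixes_0_0: "dyck_suffixes 0 0 = {[]}"
  by (subst dyck_suffixes_eq) auto

lemma dyck_suffixes_0_Suc: "dyck_suffixes 0 (Suc h) = (#) D ` dyck_suffixes 0 h"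
  by (subst dyck_suffixes_eq) auto

lemma dyck_suffixes_Suc_0: "dyck_suffixes (Suc m) 0 = (#) U ` dyck_suffixes m 1"
  by (subst dyck_suffixes_eq) auto

lemma dyck_suffixes_Suc_Suc:
  "dyck_suffixes (Suc m) (Suc h) =
     (#) U ` dyck_suffixes m (Suc (Suc h)) \<union> (#) D ` dyck_suffixes (Suc m) h"
  by (subst dyck_suffixes_eq) auto

lemma dyck_suffixes_0: "finite (dyck_suffixes 0 h) \<and> card (dyck_suffixes 0 h) = 1"
  by (induction h) (simp_all add: dyck_suffixes_0_0 dyck_suffixes_0_Suc card_image)

lemma finite_dyck_suffixes: "finite (dyck_suffixes m h)"
proof (induction m arbitrary: h)
  case (Suc m)
  show ?case
    \<comment> \<open>A first \<open>U\<close> lowers \<open>m\<close> but raises \<open>h\<close>,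
      hence the inner induction on \<open>h\<close> under an outer hypothesis for all
      heights.\<close>
    by (induction h) (simp_all add: dyck_suffixes_Suc_0 dyck_suffixes_Suc_Suc Suc)
qed (simp add: dyck_suffixes_0)

text \<open>Here \<open>j\<close> is the height just after the first up step. In the induction,
  starting with \<open>U\<close> gives the top term, and starting with \<open>D\<close> gives the
  sum for the height below.\<close>

lemma card_dyck_suffixes_Suc:
  "card (dyck_suffixes (Suc m) h) = (\<Sum>j=1..Suc h. card (dyck_suffixes m j))"
proof (induction h)
  case 0
  show ?case
    by (simp add: dyck_suffixes_Suc_0 card_image)
next
  case (Suc h)
  have "card (dyck_suffixes (Suc m) (Suc h)) =
      card (dyck_suffixes m (Suc (Suc h))) + card (dyck_suffixes (Suc m) h)"
    unfolding dyck_suffixes_Suc_Suc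
    by (subst card_Un_disjoint) (auto simp: finite_dyck_suffixes card_image)
  then show ?case
    using Suc by simp
qed

text \<open>Height \<open>h\<close> matches \<open>h + 1\<close> active values: a child by a value
  of rank \<open>r\<close> has \<open>r + 1\<close> active values, hence height \<open>r\<close>, so
  both recursions sum over \<open>1, ..., h + 1\<close>.\<close>

lemma fixed_extensions_equinumerous:
  assumes "Theta \<sigma> = \<sigma>" "card (active \<sigma>) = Suc h"
  shows "finite (fixed_extensions m \<sigma>) \<and>
    card (fixed_extensions m \<sigma>) = card (dyck_suffixes m h)"
  using assms
proof (induction m arbitrary: \<sigma> h)
  case 0
  then have "fixed_extensions 0 \<sigma> = {[]}"
    by (auto simp: fixed_extensions_def)
  then show ?case
    by (simp add: dyck_suffixes_0)
next
  case (Suc m)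
  let ?r = "\<lambda>k. card {v \<in> active \<sigma>. v \<le> k}"
  have IH: "finite (fixed_extensions m (\<sigma> @ [k])) \<and>
      card (fixed_extensions m (\<sigma> @ [k])) = card (dyck_suffixes m (?r k))"
    if "k \<in> active \<sigma>" for k
    using Suc.IH[of "\<sigma> @ [k]"] that Suc.prems(1)
    by (simp add: Theta_fixed_snoc_iff card_active_snoc)
  have "card (fixed_extensions (Suc m) \<sigma>) =
      (\<Sum>k\<in>active \<sigma>. card ((#) k ` fixed_extensions m (\<sigma> @ [k])))"
    unfolding fixed_extensions_Suc
    \<comment> \<open>The images are disjoint since their lists start with different
      \<open>k\<close>.\<close>
    by (rule card_UN_disjoint) (use IH finite_active in auto)
  also have "\<dots> = (\<Sum>k\<in>active \<sigma>. card (dyck_suffixes m (?r k)))"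
    by (rule sum.cong) (simp_all add: card_image IH)
  also have "\<dots> = (\<Sum>j=1..Suc h. card (dyck_suffixes m j))"
    using sum_over_ranks[OF finite_active, of "\<lambda>j. card (dyck_suffixes m j)" \<sigma>] Suc.prems(2)
    by simp
  also have "\<dots> = card (dyck_suffixes (Suc m) h)"
    by (simp only: card_dyck_suffixes_Suc)
  finally show ?case
    using IH finite_active by (simp add: fixed_extensions_Suc)
qed

text \<open>A fixed point satisfies the bounds of an inversion sequence automatically: its entry at
  \<open>i\<close> counts some of the \<open>i\<close> earlier positions.\<close>

lemma FP_eq_fixed_extensions: "FP n = fixed_extensions n []"
proof -
  have "0 \<le> \<sigma> ! i \<and> \<sigma> ! i < int (i + 1)" if "Theta \<sigma> = \<sigma>" "i < length \<sigma>" for \<sigma> i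
  proof -
    have "\<sigma> ! i = int (card {j. j < i \<and> \<sigma> ! j < \<sigma> ! i})"
      using arg_cong[OF that(1), of "\<lambda>xs. xs ! i"] that(2) by (simp add: Theta_def)
    moreover have "card {j. j < i \<and> \<sigma> ! j < \<sigma> ! i} \<le> card {..<i}"
      by (rule card_mono) auto
    ultimately show ?thesis
      by simp
  qed
  then show ?thesis
    by (auto simp: FP_def inversion_seqs_def fixed_extensions_def)
qed

theorem theorem4p9:
  fixes n :: nat
  shows "\<exists>\<Phi>. bij_betw \<Phi> (FP n) (dyck_paths n)"
proof -
  \<comment> \<open>One active value corresponds to starting height 0.\<close>
  have "active [] = {0}"
    by (auto simp: active_def smaller_def)
  then have "finite (FP n) \<and> card (FP n) = card (dyck_suffixes n 0)"
    using fixed_extensions_equinumerous[of "[]" 0 n]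
    by (simp add: FP_eq_fixed_extensions Theta_def)
  moreover have "dyck_paths n = dyck_suffixes n 0"
    by (simp add: dyck_paths_def dyck_suffixes_def)
  ultimately show ?thesis
    using finite_same_card_bij finite_dyck_suffixes by metis
qed

end
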